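(* Let $G=(V,E,\{c_e\}_{e\in E})$ be a finite undirected graph with positive edge conductances, each edge oriented arbitrarily, and let $w\in\mathbb{R}^E$ be a nonzero vector. Define the probability vector $\mu_w\in\mathbb{R}^V_{\ge0}$ by $$\mu_w(x):=\frac{1}{2\|w\|_2^2}\sum_{e:\,x\in e}w_e^2.$$ Let $\Pi:=C^{1/2}BL^+B^\top C^{1/2}$ and let $\overline{\Pi}$ be its entrywise absolute value. Then $$\left|w^\top\overline{\Pi}w\right|\le 2H(\mu_w)\|w\|_2^2,$$ where $H(\mu)=-\sum_x\mu(x)\log\mu(x)$ is the (natural-log) entropy, with $0\log0=0$.
   Context: For a vertex $v$, $\mathbbm{1}_v\in\mathbb{R}^V$ is the standard basis vector. For an edge $e$ oriented from $e^-$ to $e^+$, $b_e:=\mathbbm{1}_{e^+}-\mathbbm{1}_{e^-}$; $B\in\mathbb{R}^{E\times V}$ is the matrix with row $b_e^\top$ for each $e$. $C=\operatorname{diag}(c_e)_{e\in E}$, $L:=B^\top CB$ is the weighted Laplacian, and $L^+$ is its Moore–Penrose pseudoinverse. The sum $\sum_{e:x\in e}$ ranges over edges incident to $x$. Graphs have no self-loops; parallel edges are allowed. *)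

theory Defs
  imports "HOL-Analysis.Analysis"
begin

definition pinv :: "real^'n^'m \<Rightarrow> real^'m^'n" where
  "pinv A = (THE X. A ** X ** A = A \<and> X ** A ** X = X \<and>
                    transpose (A ** X) = A ** X \<and> transpose (X ** A) = X ** A)"

definition incidence :: "('e \<Rightarrow> 'v) \<Rightarrow> ('e \<Rightarrow> 'v) \<Rightarrow> real^'v^'e" where
  "incidence tail head = (\<chi> e v. (if v = head e then 1 else 0) - (if v = tail e then 1 else 0))"

definition diagm :: "('e::finite \<Rightarrow> real) \<Rightarrow> real^'e^'e" where
  "diagm d = (\<chi> i j. if i = j then d i else 0)"

definition laplacian :: "('e::finite \<Rightarrow> 'v::finite) \<Rightarrow> ('e \<Rightarrow> 'v) \<Rightarrow> ('e \<Rightarrow> real) \<Rightarrow> real^'v^'v" where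
  "laplacian tail head c = transpose (incidence tail head) ** diagm c ** incidence tail head"

definition proj_matrix :: "('e::finite \<Rightarrow> 'v::finite) \<Rightarrow> ('e \<Rightarrow> 'v) \<Rightarrow> ('e \<Rightarrow> real) \<Rightarrow> real^'e^'e" where
  "proj_matrix tail head c = diagm (\<lambda>e. sqrt (c e)) ** incidence tail head ** pinv (laplacian tail head c)
      ** transpose (incidence tail head) ** diagm (\<lambda>e. sqrt (c e))"

definition abs_matrix :: "real^'n^'m \<Rightarrow> real^'n^'m" where
  "abs_matrix A = (\<chi> i j. \<bar>A $ i $ j\<bar>)"

definition edge_measure :: "('e::finite \<Rightarrow> 'v) \<Rightarrow> ('e \<Rightarrow> 'v) \<Rightarrow> real^'e \<Rightarrow> 'v \<Rightarrow> real" where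
  "edge_measure tail head w x =
     (\<Sum>e\<in>{e. tail e = x \<or> head e = x}. (w $ e)^2) / (2 * (norm w)^2)"

definition entropy :: "('v::finite \<Rightarrow> real) \<Rightarrow> real" where
  "entropy \<mu> = - (\<Sum>x\<in>UNIV. if \<mu> x = 0 then 0 else \<mu> x * ln (\<mu> x))"

end

theory Submission
  imports Defs "HOL-Real_Asymp.Real_Asymp"
begin

text \<open>
  Let \<open>\<nu>\<close> be a positive perturbation of \<open>\<mu>\<^sub>w\<close> and let \<open>p\<^sub>t(x, y)\<close> be the heat kernel, relative to \<open>\<nu>\<close>, of the
  random walk with generator \<open>-diag(\<nu>)\<^sup>-\<^sup>1 L\<close>. Writing \<open>L\<^sup>+\<close> as the integral of this heat flow gives
  \<open>\<Pi> = 2 \<integral> \<Sum>\<^sub>y \<nu>(y) (C\<^sup>1\<^sup>/\<^sup>2 B p\<^sub>t(\<cdot>, y)) (C\<^sup>1\<^sup>/\<^sup>2 B p\<^sub>t(\<cdot>, y))\<^sup>T dt\<close>, so the quadratic form of the entrywise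
  absolute value is at most \<open>2 \<integral> \<Sum>\<^sub>y \<nu>(y) (\<Sum>\<^sub>e |w\<^sub>e| \<surd>c\<^sub>e |\<nabla>\<^sub>e p\<^sub>t(\<cdot>, y)|)\<^sup>2 dt\<close>. Since the logarithmic mean is at
  most the arithmetic mean, \<open>(\<nabla>p)\<^sup>2\<close> is at most the average of \<open>p\<close> over the edge times \<open>\<nabla>p \<nabla>ln p\<close>. By
  Cauchy-Schwarz the inner square is then at most \<open>\<parallel>w\<parallel>\<^sup>2\<close> times the energy of \<open>p\<close> against \<open>ln p\<close>,
  because the averages weighted by \<open>w\<^sub>e\<^sup>2\<close> sum to \<open>\<parallel>w\<parallel>\<^sup>2 \<Sum>\<^sub>x \<mu>\<^sub>w(x) p\<^sub>t(x, y)\<close>. That energy is the rate at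
  which the mutual information between the start and the end of the walk decays; the information
  starts at \<open>H(\<nu>)\<close> and stays nonnegative.
\<close>

section \<open>The Moore-Penrose inverse of a symmetric matrix\<close>

definition penrose_inverse :: "real^'n^'m \<Rightarrow> real^'m^'n \<Rightarrow> bool" where
  "penrose_inverse A X \<longleftrightarrow> A ** X ** A = A \<and> X ** A ** X = X \<and>
     transpose (A ** X) = A ** X \<and> transpose (X ** A) = X ** A"

text \<open>Since \<open>A = A ** Y ** A\<close>, transposing \<open>(A ** Y) ** (A ** X)\<close>
  shows that the symmetric products \<open>A ** X\<close> and \<open>A ** Y\<close> agree, and
  likewise on the other side. Then
  \<open>X = X ** A ** X = X ** A ** Y = Y ** A ** Y = Y\<close>.\<close>

lemma penrose_inverse_unique:
  assumes X: "penrose_inverse A X" and Y: "penrose_inverse A Y"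
  shows "X = Y"
proof -
  have AX: "A ** X = A ** Y"
  proof -
    have "A ** X = transpose (A ** X)" using X by (simp add: penrose_inverse_def)
    also have "\<dots> = transpose ((A ** Y) ** (A ** X))"
      using Y by (metis penrose_inverse_def matrix_mul_assoc)
    also have "\<dots> = (A ** X) ** (A ** Y)"
      using X Y by (metis penrose_inverse_def matrix_transpose_mul)
    also have "\<dots> = A ** Y" using X by (metis penrose_inverse_def matrix_mul_assoc)
    finally show ?thesis .
  qed
  have XA: "X ** A = Y ** A"
  proof -
    have "X ** A = transpose (X ** A)" using X by (simp add: penrose_inverse_def)
    also have "\<dots> = transpose ((X ** A) ** (Y ** A))"
      using Y by (metis penrose_inverse_def matrix_mul_assoc)
    also have "\<dots> = (Y ** A) ** (X ** A)"
      using X Y by (metis penrose_inverse_def matrix_transpose_mul)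
    also have "\<dots> = Y ** A" using X by (metis penrose_inverse_def matrix_mul_assoc)
    finally show ?thesis .
  qed
  show ?thesis
    using X Y AX XA by (metis penrose_inverse_def matrix_mul_assoc)
qed

lemma matrix_add_rdistrib:
  fixes A :: "real^'n^'m" and C :: "real^'k^'n"
  shows "(A + B) ** C = A ** C + B ** C"
  by (simp add: matrix_matrix_mult_def vec_eq_iff algebra_simps sum.distrib)

text \<open>\<open>J\<close> is the orthogonal projection onto the kernel, the sum of
  \<open>b b^T\<close> over an orthonormal basis. Symmetry of \<open>L\<close> turns
  \<open>L ** J = 0\<close> into \<open>J ** L = 0\<close>.\<close>

lemma exists_kernel_projection:
  fixes L :: "real^'n^'n"
  assumes sym: "transpose L = L"
  obtains J :: "real^'n^'n" where "transpose J = J" "L ** J = 0" "J ** L = 0" "\<And>x. L *v x = 0 \<Longrightarrow> J *v x = x"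
    "\<And>x. L *v (J *v x) = 0"
proof -
  define K where "K = {x. L *v x = 0}"
  have "subspace K"
    unfolding K_def subspace_def by (auto simp: matrix_vector_right_distrib matrix_vector_mult_scaleR)
  then obtain B where B: "B \<subseteq> K" "pairwise orthogonal B" "\<And>x. x \<in> B \<Longrightarrow> norm x = 1"
      "independent B" "span B = K"
    using orthonormal_basis_subspace by metis
  have fin: "finite B" using B(4) independent_bound by blast
  define J :: "real^'n^'n" where "J = (\<chi> i j. \<Sum>b\<in>B. b$i * b$j)"
  have Jx: "J *v x = (\<Sum>b\<in>B. (b \<bullet> x) *\<^sub>R b)" for x
    unfolding J_def matrix_vector_mult_def vec_eq_iff inner_vec_def
    by (auto simp: sum_distrib_left sum_distrib_right mult_ac intro: sum.swap)
  have JK: "J *v x \<in> K" for x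
    unfolding Jx using B(1) \<open>subspace K\<close> by (auto intro!: subspace_sum subspace_scale)
  have tJ: "transpose J = J" by (simp add: J_def transpose_def mult.commute)
  have LJ: "L ** J = 0"
    unfolding matrix_eq using JK by (simp flip: matrix_vector_mul_assoc add: K_def)
  have "J ** L = transpose (L ** J)" using sym tJ by (simp add: matrix_transpose_mul)
  then have JL: "J ** L = 0" using LJ by (simp add: transpose_def vec_eq_iff)
  have "J *v x = x" if "L *v x = 0" for x
  proof -
    have xK: "x \<in> span B" using that B(5) by (simp add: K_def)
    from xK show ?thesis
    proof (induction rule: span_induct_alt)
      case base
      then show ?case by simp
    next
      case (step r b y)
      have "J *v b = b"
      proof -
        have "(\<Sum>d\<in>B. (d \<bullet> b) *\<^sub>R d) = (\<Sum>d\<in>B. if d = b then b else 0)"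
          using B(2,3) step(1) by (intro sum.cong) (auto simp: pairwise_def orthogonal_def norm_eq_1)
        then show ?thesis unfolding Jx using fin step(1) by simp
      qed
      then show ?case using step(2) by (simp add: matrix_vector_right_distrib matrix_vector_mult_scaleR)
    qed
  qed
  then show ?thesis using that tJ LJ JL JK by (simp add: K_def)
qed

text \<open>Adding the kernel projection \<open>J\<close> makes \<open>L\<close> invertible: it
  supplies the identity on the kernel and leaves the orthogonal complement alone. The inverse
  \<open>K\<close> of \<open>L + J\<close> acts on the kernel as \<open>J\<close>, so
  \<open>K - J\<close> is the pseudoinverse.\<close>

lemma symmetric_penrose_inverse_exists:
  fixes L :: "real^'n^'n"
  assumes sym: "transpose L = L"
  shows "\<exists>X. penrose_inverse L X"
proof -
  obtain J :: "real^'n^'n" where J: "transpose J = J" "L ** J = 0" "J ** L = 0"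
      "\<And>x. L *v x = 0 \<Longrightarrow> J *v x = x" "\<And>x. L *v (J *v x) = 0"
    using exists_kernel_projection[OF sym] by blast
  have JJ: "J ** J = J"
    unfolding matrix_eq using J(4,5) by (simp flip: matrix_vector_mul_assoc)
  have "x = 0" if x: "(L + J) *v x = 0" for x
  proof -
    have "J *v ((L + J) *v x) = J *v x"
      by (simp add: matrix_vector_mul_assoc matrix_add_ldistrib J JJ)
    then have Jx: "J *v x = 0" using x by simp
    then have "L *v x = 0" using x by (simp add: matrix_vector_mult_add_rdistrib)
    then show "x = 0" using J(4) Jx by metis
  qed
  then obtain K where K: "K ** (L + J) = mat 1"
    using matrix_left_invertible_ker by blast
  then have K': "(L + J) ** K = mat 1" using matrix_left_right_inverse by blast
  have KJ: "K ** J = J"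
  proof -
    have "J = (K ** (L + J)) ** J" using K by simp
    also have "\<dots> = K ** J"
      by (simp flip: matrix_mul_assoc add: matrix_add_rdistrib J JJ)
    finally show ?thesis by simp
  qed
  have JK: "J ** K = J"
  proof -
    have "J = J ** ((L + J) ** K)" using K' by simp
    also have "\<dots> = J ** K"
      by (simp add: matrix_mul_assoc matrix_add_ldistrib J JJ)
    finally show ?thesis by simp
  qed
  have LK: "L ** K = mat 1 - J" using K' JK by (simp add: matrix_add_rdistrib algebra_simps)
  have KL: "K ** L = mat 1 - J" using K KJ by (simp add: matrix_add_ldistrib algebra_simps)
  have minr: "A ** (B - C) = A ** B - A ** C" for A B C :: "real^'n^'n"
    by (simp add: matrix_matrix_mult_def vec_eq_iff algebra_simps sum_subtractf)
  have minl: "(B - C) ** A = B ** A - C ** A" for A B C :: "real^'n^'n"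
    by (simp add: matrix_matrix_mult_def vec_eq_iff algebra_simps sum_subtractf)
  have tr: "transpose (mat 1 - J) = mat 1 - J"
    using J(1) by (simp add: transpose_def mat_def vec_eq_iff)
  have "penrose_inverse L (K - J)"
    unfolding penrose_inverse_def by (simp add: minr minl LK KL J JK KJ JJ tr)
  then show ?thesis by blast
qed

lemma penrose_inverse_pinv:
  fixes L :: "real^'n^'n"
  assumes "transpose L = L"
  shows "penrose_inverse L (pinv L)"
proof -
  have "\<exists>!X. penrose_inverse L X"
    using symmetric_penrose_inverse_exists[OF assms] penrose_inverse_unique by blast
  from theI'[OF this] show ?thesis unfolding pinv_def penrose_inverse_def .
qed

section \<open>Heat flow and information decay\<close>

text \<open>By homogeneity and symmetry in \<open>a\<close> and \<open>b\<close>, the comparison of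
  the two means reduces to the single variable \<open>x = a / b \<ge> 1\<close>, where the
  difference of the sides vanishes at 1 and is nondecreasing.\<close>

lemma ln_diff_ge_arith_mean:
  fixes a b :: real
  assumes "a > 0" "b > 0"
  shows "(a - b)\<^sup>2 \<le> (a + b) / 2 * ((a - b) * (ln a - ln b))"
proof -
  have *: "2 * (x - 1) \<le> (x + 1) * ln x" if "x \<ge> 1" for x :: real
  proof -
    define f where "f = (\<lambda>x::real. (x + 1) * ln x - 2 * (x - 1))"
    have "f 1 \<le> f x"
    proof (rule DERIV_nonneg_imp_nondecreasing[OF that])
      fix y :: real assume y: "1 \<le> y" "y \<le> x"
      have "(f has_real_derivative (ln y + (y + 1) / y - 2)) (at y)"
        unfolding f_def using y by (auto intro!: derivative_eq_intros simp: field_simps)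
      \<comment> \<open>The left side is \<open>ln y + 1 / y - 1\<close>, nonnegative by
        \<open>ln (1 / y) \<le> 1 / y - 1\<close>.\<close>
      moreover have "ln y + (y + 1) / y - 2 \<ge> 0"
        using ln_ge_iff[of y "1 - 1/y"] ln_le_minus_one[of "1/y"] y by (simp add: ln_div field_simps)
      ultimately show "\<exists>z. (f has_real_derivative z) (at y) \<and> 0 \<le> z" by blast
    qed
    then show ?thesis by (simp add: f_def)
  qed
  have main: "2 * (a - b) \<le> (a + b) * (ln a - ln b)" if "b \<le> a" "b > 0" for a b :: real
  proof -
    have "2 * (a / b - 1) * b \<le> (a / b + 1) * (ln a - ln b) * b"
      using *[of "a / b"] that by (intro mult_right_mono) (auto simp: ln_div)
    moreover have "2 * (a / b - 1) * b = 2 * (a - b)" "(a / b + 1) * (ln a - ln b) * b = (a + b) * (ln a - ln b)"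
      using that by (simp_all add: field_simps)
    ultimately show ?thesis by simp
  qed
  show ?thesis
  proof (cases "b \<le> a")
    case True
    have "(a - b) * (2 * (a - b)) \<le> (a - b) * ((a + b) * (ln a - ln b))"
      using main[OF True] assms True by (intro mult_left_mono) auto
    then show ?thesis by (simp add: power2_eq_square field_simps)
  next
    case False
    have "(b - a) * (2 * (b - a)) \<le> (b - a) * ((b + a) * (ln b - ln a))"
      using main[of a b] assms False by (intro mult_left_mono) auto
    then show ?thesis by (simp add: power2_eq_square field_simps)
  qed
qed

text \<open>
  Uniformization: adding a large multiple \<open>\<kappa>\<close> of the identity to the generator makes it an entrywise
  nonnegative matrix \<open>Q\<close>, so the exponential series of \<open>Q\<close> is nonnegative and the factor
  \<open>exp (- \<kappa> t)\<close> undoes the shift.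
\<close>
lemma symmetric_heat_kernel_exists:
  fixes S :: "'v::finite \<Rightarrow> 'v \<Rightarrow> real" and \<nu> :: "'v \<Rightarrow> real"
  assumes sym: "\<And>x y. S x y = S y x"
    and off_diag: "\<And>x y. x \<noteq> y \<Longrightarrow> S x y \<ge> 0"
    and \<nu>: "\<And>x. \<nu> x > 0"
  obtains p :: "real \<Rightarrow> 'v \<Rightarrow> 'v \<Rightarrow> real" where
    "\<And>x y. p 0 x y = (if x = y then 1 / \<nu> y else 0)"
    "\<And>t x y. p t x y = p t y x"
    "\<And>t x y. t \<ge> 0 \<Longrightarrow> p t x y \<ge> 0"
    "\<And>t x y. ((\<lambda>t. p t x y) has_real_derivative (\<Sum>z\<in>UNIV. S x z * p t z y) / \<nu> x) (at t)"
proof -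
  \<comment> \<open>The sum dominates each of its terms, so this one shift makes every diagonal
    entry of \<open>Q\<close> nonnegative.\<close>
  define \<kappa> where "\<kappa> = (\<Sum>x\<in>UNIV. \<bar>S x x\<bar> / \<nu> x)"
  define Q where "Q = (\<lambda>x z. (if x = z then \<kappa> else 0) + S x z / \<nu> x)"
  have Q0: "Q x z \<ge> 0" for x z
  proof (cases "x = z")
    case True
    have "\<bar>S x x\<bar> / \<nu> x \<le> \<kappa>"
      unfolding \<kappa>_def using \<nu> by (intro member_le_sum) (auto simp: less_imp_le)
    moreover have "S x x / \<nu> x \<ge> - (\<bar>S x x\<bar> / \<nu> x)" using \<nu>[of x] by (simp add: field_simps)
    ultimately show ?thesis using True by (simp add: Q_def)
  next
    case False
    then show ?thesis using off_diag[OF False] \<nu>[of x] by (simp add: Q_def)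
  qed
  \<comment> \<open>\<open>a k\<close> is the matrix \<open>Q^k diag(1 / \<nu>)\<close>, built up by
    multiplication from the left.\<close>
  define a where "a = rec_nat (\<lambda>x y. if x = y then 1 / \<nu> y else 0) (\<lambda>_ b x y. \<Sum>z\<in>UNIV. Q x z * b z y)"
  have a_0: "a 0 x y = (if x = y then 1 / \<nu> y else 0)" for x y by (simp add: a_def)
  have a_Suc: "a (Suc k) x y = (\<Sum>z\<in>UNIV. Q x z * a k z y)" for k x y by (simp add: a_def)
  have a_nonneg: "a k x y \<ge> 0" for k x y
    by (induction k arbitrary: x) (use \<nu> Q0 in \<open>auto simp: a_0 a_Suc less_imp_le intro!: sum_nonneg\<close>)
  have Q_sym: "Q x y / \<nu> y = Q y x / \<nu> x" for x y
    using \<nu>[of x] \<nu>[of y] by (auto simp: Q_def sym field_simps)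
  \<comment> \<open>The same matrix arises by multiplying from the right with the transpose of
    \<open>Q\<close>, because \<open>Q diag(1 / \<nu>)\<close> is symmetric. The two recursions
    together give the symmetry of \<open>a k\<close>.\<close>
  have a_Suc': "a (Suc k) x y = (\<Sum>z\<in>UNIV. a k x z * Q y z)" for k x y
  proof (induction k arbitrary: x y)
    case 0
    have "(\<Sum>z\<in>UNIV. Q x z * a 0 z y) = Q x y / \<nu> y"
      unfolding a_0 by (subst sum.remove[of _ y]) auto
    moreover have "(\<Sum>z\<in>UNIV. a 0 x z * Q y z) = Q y x / \<nu> x"
      unfolding a_0 by (subst sum.remove[of _ x]) auto
    ultimately show ?case using Q_sym by (simp add: a_Suc)
  next
    case (Suc k)
    have "a (Suc (Suc k)) x y = (\<Sum>z\<in>UNIV. \<Sum>u\<in>UNIV. Q x z * a k z u * Q y u)"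
      unfolding a_Suc[of "Suc k"] Suc by (simp add: sum_distrib_left mult.assoc)
    also have "\<dots> = (\<Sum>u\<in>UNIV. a (Suc k) x u * Q y u)"
      unfolding a_Suc by (subst sum.swap) (simp add: sum_distrib_right)
    finally show ?case .
  qed
  have a_sym: "a k x y = a k y x" for k x y
  proof (induction k arbitrary: x y)
    case 0 then show ?case by (auto simp: a_0)
  next
    case (Suc k)
    have "a (Suc k) x y = (\<Sum>z\<in>UNIV. Q x z * a k y z)" unfolding a_Suc using Suc by simp
    also have "\<dots> = a (Suc k) y x" unfolding a_Suc' by (simp add: mult.commute)
    finally show ?case .
  qed
  \<comment> \<open>The sum of all entries of \<open>Q\<close> dominates every row sum, so
    \<open>a k\<close> grows at most geometrically and the exponential series converges for every
    \<open>t\<close>.\<close>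
  define K where "K = (\<Sum>x\<in>UNIV. \<Sum>z\<in>UNIV. Q x z)"
  define C where "C = (\<Sum>y\<in>UNIV. 1 / \<nu> y)"
  have K0: "K \<ge> 0" using Q0 by (simp add: K_def sum_nonneg)
  have C0: "C \<ge> 0" using \<nu> by (simp add: C_def sum_nonneg less_imp_le)
  have a_le: "a k x y \<le> C * K ^ k" for k x y
  proof (induction k arbitrary: x)
    case 0
    have "1 / \<nu> y \<le> C" unfolding C_def using \<nu> by (intro member_le_sum) (auto simp: less_imp_le)
    then show ?case using C0 by (simp add: a_0)
  next
    case (Suc k)
    have "a (Suc k) x y \<le> (\<Sum>z\<in>UNIV. Q x z * (C * K ^ k))"
      unfolding a_Suc using Suc Q0 by (intro sum_mono mult_left_mono) auto
    also have "\<dots> = (\<Sum>z\<in>UNIV. Q x z) * (C * K ^ k)" by (simp add: sum_distrib_right)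
    also have "\<dots> \<le> K * (C * K ^ k)"
      unfolding K_def using Q0 C0 K0
      by (intro mult_right_mono member_le_sum[of x UNIV "\<lambda>x. \<Sum>z\<in>UNIV. Q x z"]) (auto simp: sum_nonneg K_def)
    finally show ?case by (simp add: mult_ac)
  qed
  have summ: "summable (\<lambda>k. a (k + j) x y / fact k * t ^ k)" for x y j and t :: real
  proof (rule summable_comparison_test')
    show "summable (\<lambda>k. C * K ^ j * ((K * \<bar>t\<bar>) ^ k /\<^sub>R fact k))"
      by (intro summable_mult summable_exp_generic)
    fix k :: nat
    have "a (k + j) x y * \<bar>t\<bar> ^ k \<le> C * K ^ (k + j) * \<bar>t\<bar> ^ k"
      using a_le by (intro mult_right_mono) auto
    then show "norm (a (k + j) x y / fact k * t ^ k) \<le> C * K ^ j * ((K * \<bar>t\<bar>) ^ k /\<^sub>R fact k)"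
      using a_nonneg[of "k + j" x y]
      by (simp add: abs_mult power_abs divide_simps power_add power_mult_distrib mult_ac)
  qed
  have summ0: "summable (\<lambda>k. a k x y / fact k * t ^ k)" for x y and t :: real using summ[of 0] by simp
  define f where "f = (\<lambda>t x y. \<Sum>k. a k x y / fact k * t ^ k)"
  have f_deriv: "((\<lambda>t. f t x y) has_real_derivative (\<Sum>z\<in>UNIV. Q x z * f t z y)) (at t)" for t x y
  proof -
    have "((\<lambda>t. f t x y) has_real_derivative (\<Sum>k. diffs (\<lambda>k. a k x y / fact k) k * t ^ k)) (at t)"
      unfolding f_def using summ0 by (intro termdiffs_strong_converges_everywhere) auto
    also have "(\<lambda>k. diffs (\<lambda>k. a k x y / fact k) k * t ^ k)
        = (\<lambda>k. \<Sum>z\<in>UNIV. Q x z * (a k z y / fact k * t ^ k))"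
      by (auto simp: diffs_def a_Suc sum_distrib_right sum_distrib_left sum_divide_distrib field_simps
          simp del: of_nat_Suc)
    also have "(\<Sum>k. \<Sum>z\<in>UNIV. Q x z * (a k z y / fact k * t ^ k)) = (\<Sum>z\<in>UNIV. Q x z * f t z y)"
      unfolding f_def by (subst suminf_sum) (simp_all only: summable_mult suminf_mult summ0)
    finally show ?thesis .
  qed
  define p where "p = (\<lambda>t x y. exp (- \<kappa> * t) * f t x y)"
  show ?thesis
  proof (rule that)
    show "p 0 x y = (if x = y then 1 / \<nu> y else 0)" for x y
      unfolding p_def f_def by (subst powser_zero) (simp add: a_0)
    show "p t x y = p t y x" for t x y
      unfolding p_def f_def by (subst a_sym) simp
    show "p t x y \<ge> 0" if "t \<ge> 0" for t x y
      unfolding p_def f_def using that a_nonneg summ0 by (intro mult_nonneg_nonneg suminf_nonneg) auto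
    show "((\<lambda>t. p t x y) has_real_derivative (\<Sum>z\<in>UNIV. S x z * p t z y) / \<nu> x) (at t)" for t x y
    proof -
      have "(\<Sum>z\<in>UNIV. Q x z * f t z y) = \<kappa> * f t x y + (\<Sum>z\<in>UNIV. S x z * f t z y) / \<nu> x"
        by (simp add: Q_def distrib_right sum.distrib sum_divide_distrib if_distrib[of "\<lambda>u. u * _"] cong: if_cong)
      then have "((\<lambda>t. p t x y) has_real_derivative
          (exp (- \<kappa> * t) * (- \<kappa>) * f t x y + exp (- \<kappa> * t) * (\<kappa> * f t x y + (\<Sum>z\<in>UNIV. S x z * f t z y) / \<nu> x))) (at t)"
        unfolding p_def by (auto intro!: derivative_eq_intros f_deriv)
      also have "exp (- \<kappa> * t) * (- \<kappa>) * f t x y + exp (- \<kappa> * t) * (\<kappa> * f t x y + (\<Sum>z\<in>UNIV. S x z * f t z y) / \<nu> x)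
         = (\<Sum>z\<in>UNIV. S x z * p t z y) / \<nu> x"
        by (simp add: p_def algebra_simps sum_distrib_left)
      finally show ?thesis .
    qed
  qed
qed

lemma DERIV_mult_ln_self:
  fixes f :: "real \<Rightarrow> real"
  assumes "(f has_real_derivative d) (at x)" "f x > 0"
  shows "((\<lambda>x. f x * ln (f x)) has_real_derivative d * (ln (f x) + 1)) (at x)"
  using assms by (auto intro!: derivative_eq_intros simp: algebra_simps)

lemma DERIV_add_const:
  "(f has_real_derivative d) F \<Longrightarrow> ((\<lambda>x. f x + k) has_real_derivative d) F"
  by (auto intro!: derivative_eq_intros)

section \<open>Gradient, Laplacian and Dirichlet energy of a graph\<close>

locale conductance_graph =
  fixes tail head :: "'e::finite \<Rightarrow> 'v::finite" and c :: "'e \<Rightarrow> real"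
  assumes no_loops: "tail e \<noteq> head e" and pos: "c e > 0"
begin

definition grad :: "('v \<Rightarrow> real) \<Rightarrow> 'e \<Rightarrow> real" where
  "grad u e = u (head e) - u (tail e)"

definition inc :: "'e \<Rightarrow> 'v \<Rightarrow> real" where
  "inc e x = incidence tail head $ e $ x"

definition Lap :: "('v \<Rightarrow> real) \<Rightarrow> 'v \<Rightarrow> real" where
  "Lap u x = (\<Sum>e\<in>UNIV. c e * grad u e * inc e x)"

definition energy :: "('v \<Rightarrow> real) \<Rightarrow> ('v \<Rightarrow> real) \<Rightarrow> real" where
  "energy u v = (\<Sum>e\<in>UNIV. c e * grad u e * grad v e)"

lemma sum_inc: "(\<Sum>x\<in>UNIV. inc e x * u x) = grad u e"
  by (simp add: inc_def incidence_def grad_def left_diff_distrib sum_subtractf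
      if_distrib[of "\<lambda>z. z * _"] cong: if_cong)

text \<open>Summation by parts: once the sums are exchanged, \<open>v\<close> is paired with each
  incidence row, which yields its gradient.\<close>

lemma green: "(\<Sum>x\<in>UNIV. v x * Lap u x) = energy u v"
proof -
  have "(\<Sum>x\<in>UNIV. v x * Lap u x) = (\<Sum>e\<in>UNIV. \<Sum>x\<in>UNIV. c e * grad u e * (inc e x * v x))"
    unfolding Lap_def by (subst sum.swap) (simp add: sum_distrib_left mult_ac)
  also have "\<dots> = energy u v"
    by (simp add: energy_def sum_inc flip: sum_distrib_left)
  finally show ?thesis .
qed

lemma energy_commute: "energy u v = energy v u"
  by (simp add: energy_def mult_ac)

lemma Lap_sum: "Lap (\<lambda>x. \<Sum>y\<in>A. k y * u y x) x = (\<Sum>y\<in>A. k y * Lap (u y) x)"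
proof -
  have "grad (\<lambda>x. \<Sum>y\<in>A. k y * u y x) e = (\<Sum>y\<in>A. k y * grad (u y) e)" for e
    by (simp add: grad_def sum_subtractf right_diff_distrib)
  then show ?thesis
    unfolding Lap_def by (simp add: sum_distrib_left sum_distrib_right mult_ac, subst sum.swap) simp
qed

lemma grad_le_energy: "c e * (grad u e)\<^sup>2 \<le> energy u u"
proof -
  have "energy u u = (\<Sum>e\<in>UNIV. c e * (grad u e)\<^sup>2)"
    by (simp add: energy_def power2_eq_square mult.assoc)
  then show ?thesis
    using pos by (auto intro!: member_le_sum[of e UNIV "\<lambda>e. c e * (grad u e)\<^sup>2"] simp: less_imp_le)
qed

text \<open>The doubled sign exposes the matrix of \<open>- Lap\<close>, whose off-diagonal entries
  are nonnegative, as the heat kernel construction requires.\<close>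

lemma Lap_eq_sum: "Lap u x = - (\<Sum>z\<in>UNIV. (- (\<Sum>e\<in>UNIV. c e * inc e x * inc e z)) * u z)"
proof -
  have "(\<Sum>z\<in>UNIV. (\<Sum>e\<in>UNIV. c e * inc e x * inc e z) * u z)
      = (\<Sum>e\<in>UNIV. c e * inc e x * (\<Sum>z\<in>UNIV. inc e z * u z))"
    by (simp add: sum_distrib_right sum_distrib_left mult.assoc, subst sum.swap) simp
  also have "\<dots> = Lap u x"
    unfolding sum_inc by (simp add: Lap_def mult_ac)
  finally show ?thesis by (simp add: sum_negf)
qed

end

section \<open>The heat equation with vertex weights\<close>

locale weighted_conductance_graph = conductance_graph tail head c
  for tail head :: "'e::finite \<Rightarrow> 'v::finite" and c :: "'e \<Rightarrow> real" +
  fixes \<nu> :: "'v \<Rightarrow> real"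
  assumes \<nu>_pos: "\<nu> x > 0"
begin

lemma \<nu>_nonzero [simp]: "\<nu> x \<noteq> 0"
  using \<nu>_pos[of x] by simp

text \<open>All real times are included, so two-sided derivatives are available at time 0.\<close>

definition solves_heat :: "(real \<Rightarrow> 'v \<Rightarrow> real) \<Rightarrow> bool" where
  "solves_heat u \<longleftrightarrow> (\<forall>t x. ((\<lambda>t. u t x) has_real_derivative - Lap (u t) x / \<nu> x) (at t))"

lemma solves_heatD:
  "solves_heat u \<Longrightarrow> ((\<lambda>t. u t x) has_real_derivative - Lap (u t) x / \<nu> x) (at t)"
  by (simp add: solves_heat_def)

text \<open>The product rule gives two energies, each with one argument replaced by its time
  derivative \<open>- Lap / \<nu>\<close>; Green's formula makes them equal.\<close>

lemma energy_has_derivative: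
  assumes u: "solves_heat u" and v: "solves_heat v"
  shows "((\<lambda>t. energy (u t) (v t)) has_real_derivative
      - 2 * (\<Sum>x\<in>UNIV. Lap (u t) x * Lap (v t) x / \<nu> x)) (at t)"
proof -
  define u' where "u' = (\<lambda>x. - Lap (u t) x / \<nu> x)"
  define v' where "v' = (\<lambda>x. - Lap (v t) x / \<nu> x)"
  have g: "((\<lambda>t. grad (u t) e) has_real_derivative grad u' e) (at t)"
    "((\<lambda>t. grad (v t) e) has_real_derivative grad v' e) (at t)" for e
    unfolding grad_def u'_def v'_def by (intro DERIV_diff solves_heatD u v)+
  have "((\<lambda>t. energy (u t) (v t)) has_real_derivative
      (\<Sum>e\<in>UNIV. c e * grad u' e * grad (v t) e + grad v' e * (c e * grad (u t) e))) (at t)"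
    unfolding energy_def by (intro DERIV_sum DERIV_mult DERIV_cmult g)
  also have "(\<Sum>e\<in>UNIV. c e * grad u' e * grad (v t) e + grad v' e * (c e * grad (u t) e))
      = energy (v t) u' + energy (u t) v'"
    by (simp add: energy_def sum.distrib mult_ac)
  also have "\<dots> = - 2 * (\<Sum>x\<in>UNIV. Lap (u t) x * Lap (v t) x / \<nu> x)"
    by (simp add: u'_def v'_def mult_ac sum_negf flip: green)
  finally show ?thesis .
qed

text \<open>The weighted norm \<open>N\<close> decreases at rate twice the energy, and the energy is
  itself nonincreasing, so it decays like \<open>1 / t\<close>. Only gradients can vanish in
  general, as constants are stationary.\<close>

lemma heat_gradient_tendsto_0:
  assumes u: "solves_heat u"
  shows "((\<lambda>t. grad (u t) e) \<longlongrightarrow> 0) at_top"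
proof -
  define N where "N = (\<lambda>t. \<Sum>x\<in>UNIV. \<nu> x * (u t x)\<^sup>2)"
  \<comment> \<open>Decreasing, since the energy is: hence the energy is at most \<open>N 0 / (2 t)\<close>.\<close>
  define f where "f = (\<lambda>t. N t + 2 * t * energy (u t) (u t))"
  have N': "(N has_real_derivative - 2 * energy (u t) (u t)) (at t)" for t
  proof -
    have "(N has_real_derivative (\<Sum>x\<in>UNIV. \<nu> x * (2 * u t x * (- Lap (u t) x / \<nu> x)))) (at t)"
      unfolding N_def by (auto intro!: derivative_eq_intros solves_heatD[OF u] simp: mult_ac)
    also have "(\<Sum>x\<in>UNIV. \<nu> x * (2 * u t x * (- Lap (u t) x / \<nu> x))) = (\<Sum>x\<in>UNIV. - 2 * (u t x * Lap (u t) x))"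
      by (intro sum.cong refl) (simp add: mult_ac)
    also have "\<dots> = - 2 * energy (u t) (u t)"
      by (simp only: green flip: sum_distrib_left)
    finally show ?thesis .
  qed
  have "f t \<le> f 0" if "t \<ge> 0" for t
  proof (rule DERIV_nonpos_imp_nonincreasing[OF that])
    fix s :: real assume s: "0 \<le> s" "s \<le> t"
    have "(f has_real_derivative 2 * s * (- 2 * (\<Sum>x\<in>UNIV. Lap (u s) x * Lap (u s) x / \<nu> x))) (at s)"
      unfolding f_def by (auto intro!: derivative_eq_intros N' energy_has_derivative[OF u u])
    moreover have "(\<Sum>x\<in>UNIV. Lap (u s) x * Lap (u s) x / \<nu> x) \<ge> 0"
      using \<nu>_pos by (intro sum_nonneg) (simp add: less_imp_le)
    ultimately show "\<exists>y. (f has_real_derivative y) (at s) \<and> y \<le> 0"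
      using s by (intro exI conjI) (auto simp: mult_nonneg_nonneg)
  qed
  moreover have "N t \<ge> 0" for t
    unfolding N_def using \<nu>_pos by (intro sum_nonneg) (simp add: less_imp_le)
  ultimately have E: "2 * t * energy (u t) (u t) \<le> f 0" if "t \<ge> 0" for t
    using that unfolding f_def by (smt (verit))
  have "((\<lambda>t. (grad (u t) e)\<^sup>2) \<longlongrightarrow> 0) at_top"
  proof (rule tendsto_sandwich[where f = "\<lambda>_. 0" and h = "\<lambda>t. f 0 / (2 * c e) / t"])
    show "eventually (\<lambda>t. (grad (u t) e)\<^sup>2 \<le> f 0 / (2 * c e) / t) at_top"
      using eventually_gt_at_top[of 0]
    proof eventually_elim
      case (elim t)
      have "2 * t * (c e * (grad (u t) e)\<^sup>2) \<le> 2 * t * energy (u t) (u t)"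
        using elim grad_le_energy by (intro mult_left_mono) auto
      also have "\<dots> \<le> f 0" using E elim by simp
      finally show ?case using elim pos[of e] by (simp add: field_simps)
    qed
    show "((\<lambda>t. f 0 / (2 * c e) / t) \<longlongrightarrow> 0) at_top"
      by (rule real_tendsto_divide_at_top[OF tendsto_const filterlim_ident])
  qed auto
  then show ?thesis by simp
qed

lemma heat_energy_tendsto_0:
  assumes "solves_heat u" "solves_heat v"
  shows "((\<lambda>t. energy (u t) (v t)) \<longlongrightarrow> 0) at_top"
  unfolding energy_def
proof (rule tendsto_null_sum)
  fix e
  show "((\<lambda>t. c e * grad (u t) e * grad (v t) e) \<longlongrightarrow> 0) at_top"
    using tendsto_mult[OF tendsto_mult[OF tendsto_const[of "c e"] heat_gradient_tendsto_0] heat_gradient_tendsto_0] assms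
    by fastforce
qed

text \<open>A density relative to \<open>\<nu>\<close>: the transition probability is
  \<open>p t x y * \<nu> y\<close>, and the factor \<open>1 / \<nu> y\<close> at time 0 is what
  allows symmetry.\<close>

definition heat_kernel :: "(real \<Rightarrow> 'v \<Rightarrow> 'v \<Rightarrow> real) \<Rightarrow> bool" where
  "heat_kernel p \<longleftrightarrow>
     (\<forall>x y. p 0 x y = (if x = y then 1 / \<nu> y else 0)) \<and>
     (\<forall>t x y. p t x y = p t y x) \<and>
     (\<forall>t\<ge>0. \<forall>x y. p t x y \<ge> 0) \<and>
     (\<forall>y. solves_heat (\<lambda>t x. p t x y))"

text \<open>The two ends of an edge carry opposite incidence signs, so the negated Laplacian is
  nonnegative off the diagonal.\<close>

lemma ex_heat_kernel: "\<exists>p. heat_kernel p"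
proof -
  define S where "S = (\<lambda>x z. - (\<Sum>e\<in>UNIV. c e * inc e x * inc e z))"
  have sym: "S x z = S z x" for x z by (simp add: S_def mult_ac)
  have off: "S x z \<ge> 0" if "x \<noteq> z" for x z
  proof -
    have "inc e x * inc e z \<le> 0" for e
      using that no_loops[of e] by (auto simp: inc_def incidence_def)
    then have "c e * (inc e x * inc e z) \<le> 0" for e
      using pos[of e] by (simp add: mult_nonneg_nonpos)
    then show ?thesis unfolding S_def by (simp add: sum_nonpos mult.assoc)
  qed
  have Lap: "- Lap u x = (\<Sum>z\<in>UNIV. S x z * u z)" for u x
    unfolding S_def by (subst Lap_eq_sum) simp
  from symmetric_heat_kernel_exists[of S \<nu>, OF sym off \<nu>_pos] obtain p where
    "\<And>x y. p 0 x y = (if x = y then 1 / \<nu> y else 0)"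
    "\<And>t x y. p t x y = p t y x"
    "\<And>t x y. t \<ge> 0 \<Longrightarrow> p t x y \<ge> 0"
    "\<And>t x y. ((\<lambda>t. p t x y) has_real_derivative (\<Sum>z\<in>UNIV. S x z * p t z y) / \<nu> x) (at t)"
    by blast
  then have "heat_kernel p"
    unfolding heat_kernel_def solves_heat_def Lap by blast
  then show ?thesis by blast
qed

section \<open>The heat kernel, its semigroup and the decay of information\<close>

context
  fixes p :: "real \<Rightarrow> 'v \<Rightarrow> 'v \<Rightarrow> real"
  assumes p: "heat_kernel p"
begin

lemma kernel_0: "p 0 x y = (if x = y then 1 / \<nu> y else 0)"
  and kernel_sym: "p t x y = p t y x"
  and kernel_nonneg: "t \<ge> 0 \<Longrightarrow> p t x y \<ge> 0"
  and kernel_solves: "solves_heat (\<lambda>t x. p t x y)"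
  using p unfolding heat_kernel_def by blast+

text \<open>Both sides are minus the time derivative of \<open>p t x y\<close>, computed through
  either space variable.\<close>

lemma kernel_Lap_commute:
  "Lap (\<lambda>z. p t z y) x / \<nu> x = Lap (\<lambda>z. p t z x) y / \<nu> y"
proof -
  have "((\<lambda>t. p t x y) has_real_derivative - Lap (\<lambda>z. p t z y) x / \<nu> x) (at t)"
    using solves_heatD[OF kernel_solves[of y]] .
  moreover have "((\<lambda>t. p t x y) has_real_derivative - Lap (\<lambda>z. p t z x) y / \<nu> y) (at t)"
    using solves_heatD[OF kernel_solves[of x], of y t] by (subst kernel_sym)
  ultimately show ?thesis using DERIV_unique by fastforce
qed

text \<open>The time derivative is minus the energy against the constant 1, hence 0.\<close>

lemma kernel_mass: "(\<Sum>x\<in>UNIV. \<nu> x * p t x y) = 1"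
proof -
  have "((\<lambda>t. \<Sum>x\<in>UNIV. \<nu> x * p t x y) has_real_derivative 0) (at t)" for t
  proof -
    have "((\<lambda>t. \<Sum>x\<in>UNIV. \<nu> x * p t x y) has_real_derivative
        (\<Sum>x\<in>UNIV. \<nu> x * (- Lap (\<lambda>z. p t z y) x / \<nu> x))) (at t)"
      by (intro DERIV_sum DERIV_cmult solves_heatD[OF kernel_solves])
    also have "(\<Sum>x\<in>UNIV. \<nu> x * (- Lap (\<lambda>z. p t z y) x / \<nu> x)) = - (\<Sum>x\<in>UNIV. 1 * Lap (\<lambda>z. p t z y) x)"
      by (simp add: sum_negf)
    also have "\<dots> = 0"
      by (simp only: green) (simp add: energy_def grad_def)
    finally show ?thesis .
  qed
  then have "(\<Sum>x\<in>UNIV. \<nu> x * p t x y) = (\<Sum>x\<in>UNIV. \<nu> x * p 0 x y)"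
    by (intro DERIV_isconst_all) auto
  also have "\<dots> = 1"
    by (simp add: kernel_0 if_distrib[of "\<lambda>z. _ * z"] cong: if_cong)
  finally show ?thesis .
qed

definition flow :: "('v \<Rightarrow> real) \<Rightarrow> real \<Rightarrow> 'v \<Rightarrow> real" where
  "flow g t x = (\<Sum>y\<in>UNIV. \<nu> y * g y * p t x y)"

lemma flow_0: "flow g 0 = g"
  by (auto simp: flow_def kernel_0 if_distrib[of "\<lambda>z. _ * z"] cong: if_cong)

lemma Lap_flow_eq: "Lap (flow g t) x = (\<Sum>y\<in>UNIV. \<nu> y * g y * Lap (\<lambda>z. p t z y) x)"
proof -
  have "flow g t = (\<lambda>x. \<Sum>y\<in>UNIV. (\<nu> y * g y) * p t x y)" by (simp add: flow_def fun_eq_iff)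
  then show ?thesis by (simp add: Lap_sum)
qed

lemma flow_solves: "solves_heat (flow g)"
  unfolding solves_heat_def
proof (intro allI)
  fix t x
  have "((\<lambda>t. flow g t x) has_real_derivative
      (\<Sum>y\<in>UNIV. \<nu> y * g y * (- Lap (\<lambda>z. p t z y) x / \<nu> x))) (at t)"
    unfolding flow_def by (intro DERIV_sum DERIV_cmult solves_heatD[OF kernel_solves])
  also have "(\<Sum>y\<in>UNIV. \<nu> y * g y * (- Lap (\<lambda>z. p t z y) x / \<nu> x)) = - Lap (flow g t) x / \<nu> x"
    by (simp add: Lap_flow_eq sum_divide_distrib sum_negf)
  finally show "((\<lambda>t. flow g t x) has_real_derivative - Lap (flow g t) x / \<nu> x) (at t)" .
qed

text \<open>Self-adjointness moves the Laplacian from the kernel onto \<open>g\<close>, where it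
  becomes the incidence row of \<open>e\<close>; pairing that row with the kernel gives a
  gradient.\<close>

lemma Lap_flow:
  assumes g: "\<And>x. Lap g x = inc e x"
  shows "Lap (flow g t) x = \<nu> x * grad (\<lambda>z. p t z x) e"
proof -
  have "Lap (flow g t) x = (\<Sum>y\<in>UNIV. \<nu> x * (g y * Lap (\<lambda>z. p t z x) y))"
    unfolding Lap_flow_eq
  proof (intro sum.cong refl)
    fix y
    have "\<nu> y * Lap (\<lambda>z. p t z y) x = \<nu> x * Lap (\<lambda>z. p t z x) y"
      using kernel_Lap_commute[of t y x] \<nu>_pos[of x] \<nu>_pos[of y] by (simp add: field_simps)
    then show "\<nu> y * g y * Lap (\<lambda>z. p t z y) x = \<nu> x * (g y * Lap (\<lambda>z. p t z x) y)"
      by (metis mult.commute mult.left_commute)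
  qed
  also have "\<dots> = \<nu> x * energy (\<lambda>z. p t z x) g"
    by (simp only: green flip: sum_distrib_left)
  also have "energy (\<lambda>z. p t z x) g = (\<Sum>y\<in>UNIV. p t y x * Lap g y)"
    by (simp only: green energy_commute)
  also have "\<dots> = grad (\<lambda>z. p t z x) e"
    by (simp add: g mult.commute flip: sum_inc)
  finally show ?thesis .
qed

text \<open>This is the differential form of the integral representation of \<Pi>: the flow energy
  starts at \<open>energy g h\<close> and tends to 0.\<close>

lemma flow_energy_has_derivative:
  assumes "\<And>x. Lap g x = inc e x" "\<And>x. Lap h x = inc f x"
  shows "((\<lambda>t. energy (flow g t) (flow h t)) has_real_derivative
      - 2 * (\<Sum>x\<in>UNIV. \<nu> x * (grad (\<lambda>z. p t z x) e * grad (\<lambda>z. p t z x) f))) (at t)"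
proof -
  have "(\<Sum>x\<in>UNIV. Lap (flow g t) x * Lap (flow h t) x / \<nu> x)
      = (\<Sum>x\<in>UNIV. \<nu> x * (grad (\<lambda>z. p t z x) e * grad (\<lambda>z. p t z x) f))"
    by (simp add: Lap_flow[OF assms(1)] Lap_flow[OF assms(2)] mult_ac)
  then show ?thesis
    using energy_has_derivative[OF flow_solves flow_solves, of g h t] by simp
qed

text \<open>
  Constants are stationary, so \<open>p + \<eta>\<close> also solves the heat equation; the shift keeps the logarithm
  away from \<open>ln 0\<close> at time \<open>0\<close> and between different components.
\<close>
definition info :: "real \<Rightarrow> real \<Rightarrow> real" where
  "info \<eta> t = (\<Sum>y\<in>UNIV. \<Sum>x\<in>UNIV. \<nu> y * (\<nu> x * ((p t x y + \<eta>) * ln (p t x y + \<eta>))))"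

text \<open>The derivative of \<open>s * ln s\<close> is \<open>ln s + 1\<close>; the summand 1 has
  zero gradient and drops out of the energy.\<close>

lemma info_has_derivative:
  assumes "\<eta> > 0" "t \<ge> 0"
  shows "(info \<eta> has_real_derivative
     - (\<Sum>y\<in>UNIV. \<nu> y * energy (\<lambda>x. p t x y) (\<lambda>x. ln (p t x y + \<eta>)))) (at t)"
proof -
  have pos': "p t x y + \<eta> > 0" for x y using kernel_nonneg[OF assms(2), of x y] assms(1) by linarith
  have "(info \<eta> has_real_derivative
     (\<Sum>y\<in>UNIV. \<Sum>x\<in>UNIV. \<nu> y * (\<nu> x * ((- Lap (\<lambda>z. p t z y) x / \<nu> x) * (ln (p t x y + \<eta>) + 1))))) (at t)"
    unfolding info_def[abs_def]
  proof (intro DERIV_sum DERIV_cmult)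
    fix x y
    show "((\<lambda>t. (p t x y + \<eta>) * ln (p t x y + \<eta>)) has_real_derivative
        - Lap (\<lambda>z. p t z y) x / \<nu> x * (ln (p t x y + \<eta>) + 1)) (at t)"
      by (intro DERIV_mult_ln_self pos' DERIV_add_const solves_heatD[OF kernel_solves])
  qed
  also have "(\<Sum>y\<in>UNIV. \<Sum>x\<in>UNIV. \<nu> y * (\<nu> x * ((- Lap (\<lambda>z. p t z y) x / \<nu> x) * (ln (p t x y + \<eta>) + 1))))
     = - (\<Sum>y\<in>UNIV. \<nu> y * (\<Sum>x\<in>UNIV. (ln (p t x y + \<eta>) + 1) * Lap (\<lambda>z. p t z y) x))"
    by (simp add: sum_distrib_left sum_negf mult_ac)
  also have "\<dots> = - (\<Sum>y\<in>UNIV. \<nu> y * energy (\<lambda>x. p t x y) (\<lambda>x. ln (p t x y + \<eta>)))"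
    by (simp only: green) (simp add: energy_def grad_def)
  finally show ?thesis .
qed

text \<open>Sum \<open>s * ln s \<ge> s - 1\<close> with the weights \<open>\<nu>\<close>, using
  that the kernel has mass 1. The bound tends to 0 as \<open>N\<close> tends to 1 and
  \<open>\<eta>\<close> to 0.\<close>

lemma info_lower_bound:
  assumes "\<eta> > 0" "t \<ge> 0"
  defines "N \<equiv> \<Sum>x\<in>UNIV. \<nu> x"
  shows "N * (1 + \<eta> * N - N) \<le> info \<eta> t"
proof -
  have "N * (1 + \<eta> * N - N) = (\<Sum>y\<in>UNIV. \<nu> y * (\<Sum>x\<in>UNIV. \<nu> x * (p t x y + \<eta> - 1)))"
    by (simp add: algebra_simps sum.distrib sum_subtractf kernel_mass N_def
        sum_distrib_left sum_distrib_right)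
  also have "\<dots> \<le> (\<Sum>y\<in>UNIV. \<nu> y * (\<Sum>x\<in>UNIV. \<nu> x * ((p t x y + \<eta>) * ln (p t x y + \<eta>))))"
  proof (intro sum_mono mult_left_mono)
    fix x y
    have q: "p t x y + \<eta> > 0" using kernel_nonneg[OF assms(2), of x y] assms(1) by linarith
    have "1 - 1 / (p t x y + \<eta>) \<le> ln (p t x y + \<eta>)"
      using ln_le_minus_one[of "1 / (p t x y + \<eta>)"] q by (simp add: ln_div)
    then have "(p t x y + \<eta>) * (1 - 1 / (p t x y + \<eta>)) \<le> (p t x y + \<eta>) * ln (p t x y + \<eta>)"
      using q by (intro mult_left_mono) auto
    moreover have "(p t x y + \<eta>) * (1 - 1 / (p t x y + \<eta>)) = p t x y + \<eta> - 1"
      using q by (simp add: field_simps)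
    ultimately show "p t x y + \<eta> - 1 \<le> (p t x y + \<eta>) * ln (p t x y + \<eta>)" by simp
  qed (use \<nu>_pos in \<open>auto simp: less_imp_le\<close>)
  also have "\<dots> = info \<eta> t" by (simp add: info_def sum_distrib_left)
  finally show ?thesis .
qed

text \<open>Cauchy-Schwarz with the gradient split as \<open>sqrt (m e) * sqrt (d e)\<close>: the
  mean \<open>m\<close> goes with \<open>w\<close> and is controlled by \<open>W\<close>, while
  \<open>d\<close> goes with \<open>c\<close> and sums to the energy. The factor
  \<open>1 + \<eta> * N\<close> is the mass of the shifted kernel.\<close>

lemma weighted_gradient_le:
  fixes w :: "'e \<Rightarrow> real"
  assumes \<eta>: "\<eta> > 0" and t: "t \<ge> 0"
    and W: "\<And>u. (\<And>x. u x \<ge> 0) \<Longrightarrow>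
        (\<Sum>e\<in>UNIV. (w e)\<^sup>2 * ((u (head e) + u (tail e)) / 2)) \<le> W * (\<Sum>x\<in>UNIV. \<nu> x * u x)"
  shows "(\<Sum>e\<in>UNIV. \<bar>w e\<bar> * sqrt (c e) * \<bar>grad (\<lambda>x. p t x y) e\<bar>)\<^sup>2
     \<le> W * (1 + \<eta> * (\<Sum>x\<in>UNIV. \<nu> x)) * energy (\<lambda>x. p t x y) (\<lambda>x. ln (p t x y + \<eta>))"
proof -
  define q where "q = (\<lambda>x. p t x y + \<eta>)"
  define m where "m = (\<lambda>e. (q (head e) + q (tail e)) / 2)"
  define d where "d = (\<lambda>e. grad (\<lambda>x. p t x y) e * grad (\<lambda>x. ln (q x)) e)"
  have q: "q x > 0" for x using kernel_nonneg[OF t, of x y] \<eta> by (simp add: q_def)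
  have m: "m e > 0" for e using q by (simp add: m_def add_pos_pos)
  have gd: "(grad (\<lambda>x. p t x y) e)\<^sup>2 \<le> m e * d e" for e
    using ln_diff_ge_arith_mean[OF q q, of "head e" "tail e"]
    by (simp add: m_def d_def grad_def q_def)
  have d: "d e \<ge> 0" for e
    using order_trans[OF zero_le_power2 gd[of e]] m[of e] by (simp add: zero_le_mult_iff)
  have "(\<Sum>e\<in>UNIV. \<bar>w e\<bar> * sqrt (c e) * \<bar>grad (\<lambda>x. p t x y) e\<bar>)
      \<le> (\<Sum>e\<in>UNIV. (\<bar>w e\<bar> * sqrt (m e)) * sqrt (c e * d e))"
  proof (rule sum_mono)
    fix e
    have "\<bar>grad (\<lambda>x. p t x y) e\<bar> \<le> sqrt (m e) * sqrt (d e)"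
      using real_sqrt_le_mono[OF gd[of e]] by (simp add: real_sqrt_mult)
    then have "\<bar>w e\<bar> * sqrt (c e) * \<bar>grad (\<lambda>x. p t x y) e\<bar> \<le> \<bar>w e\<bar> * sqrt (c e) * (sqrt (m e) * sqrt (d e))"
      using pos[of e] by (intro mult_left_mono) auto
    then show "\<bar>w e\<bar> * sqrt (c e) * \<bar>grad (\<lambda>x. p t x y) e\<bar> \<le> (\<bar>w e\<bar> * sqrt (m e)) * sqrt (c e * d e)"
      by (simp add: real_sqrt_mult mult_ac)
  qed
  then have "(\<Sum>e\<in>UNIV. \<bar>w e\<bar> * sqrt (c e) * \<bar>grad (\<lambda>x. p t x y) e\<bar>)\<^sup>2
      \<le> (\<Sum>e\<in>UNIV. (\<bar>w e\<bar> * sqrt (m e)) * sqrt (c e * d e))\<^sup>2"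
    using pos by (intro power_mono) (auto intro!: sum_nonneg simp: less_imp_le)
  also have "\<dots> \<le> (\<Sum>e\<in>UNIV. (\<bar>w e\<bar> * sqrt (m e))\<^sup>2) * (\<Sum>e\<in>UNIV. (sqrt (c e * d e))\<^sup>2)"
    by (rule Cauchy_Schwarz_ineq_sum)
  also have "\<dots> = (\<Sum>e\<in>UNIV. (w e)\<^sup>2 * m e) * (\<Sum>e\<in>UNIV. c e * d e)"
    using m d pos by (simp add: power_mult_distrib less_imp_le)
  also have "\<dots> \<le> (W * (\<Sum>x\<in>UNIV. \<nu> x * q x)) * (\<Sum>e\<in>UNIV. c e * d e)"
    using W[of q] q d pos by (intro mult_right_mono sum_nonneg) (auto simp: m_def less_imp_le)
  also have "(\<Sum>x\<in>UNIV. \<nu> x * q x) = 1 + \<eta> * (\<Sum>x\<in>UNIV. \<nu> x)"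
    by (simp add: q_def distrib_left sum.distrib kernel_mass mult.commute flip: sum_distrib_left)
  also have "(\<Sum>e\<in>UNIV. c e * d e) = energy (\<lambda>x. p t x y) (\<lambda>x. ln (p t x y + \<eta>))"
    by (simp add: energy_def d_def q_def mult.assoc)
  finally show ?thesis .
qed

text \<open>The coefficients \<open>k\<close> are fixed in time, so their signs can be chosen to
  produce the absolute values of the entries of \<Pi>. Comparing derivatives of
  \<open>\<Phi>\<close> and \<open>info\<close> replaces integration over time.\<close>

lemma potential_energy_le_info:
  fixes w :: "'e \<Rightarrow> real" and g :: "'e \<Rightarrow> 'v \<Rightarrow> real"
  assumes \<eta>: "\<eta> > 0"
    and W: "\<And>u. (\<And>x. u x \<ge> 0) \<Longrightarrow>
        (\<Sum>e\<in>UNIV. (w e)\<^sup>2 * ((u (head e) + u (tail e)) / 2)) \<le> W * (\<Sum>x\<in>UNIV. \<nu> x * u x)"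
    and W0: "W \<ge> 0"
    and g: "\<And>e x. Lap (g e) x = inc e x"
    and k: "\<And>e f. \<bar>k e f\<bar> \<le> (\<bar>w e\<bar> * sqrt (c e)) * (\<bar>w f\<bar> * sqrt (c f))"
  defines "N \<equiv> \<Sum>x\<in>UNIV. \<nu> x"
  shows "(\<Sum>e\<in>UNIV. \<Sum>f\<in>UNIV. k e f * energy (g e) (g f))
      \<le> 2 * W * (1 + \<eta> * N) * (info \<eta> 0 - N * (1 + \<eta> * N - N))"
proof -
  define \<Phi> where "\<Phi> = (\<lambda>t. \<Sum>e\<in>UNIV. \<Sum>f\<in>UNIV. k e f * energy (flow (g e) t) (flow (g f) t))"
  define K where "K = 2 * W * (1 + \<eta> * N)"
  have N: "N \<ge> 0" unfolding N_def using \<nu>_pos by (intro sum_nonneg) (auto simp: less_imp_le)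
  then have K: "K \<ge> 0" using W0 \<eta> by (simp add: K_def)
  define D where "D = (\<lambda>t x e. grad (\<lambda>z. p t z x) e)"
  have \<Phi>': "(\<Phi> has_real_derivative
      - 2 * (\<Sum>x\<in>UNIV. \<nu> x * (\<Sum>e\<in>UNIV. \<Sum>f\<in>UNIV. k e f * (D t x e * D t x f)))) (at t)" for t
  proof -
    have "(\<Phi> has_real_derivative (\<Sum>e\<in>UNIV. \<Sum>f\<in>UNIV. k e f *
        (- 2 * (\<Sum>x\<in>UNIV. \<nu> x * (D t x e * D t x f))))) (at t)"
      unfolding \<Phi>_def D_def by (intro DERIV_sum DERIV_cmult flow_energy_has_derivative g)
    also have "(\<Sum>e\<in>UNIV. \<Sum>f\<in>UNIV. k e f * (- 2 * (\<Sum>x\<in>UNIV. \<nu> x * (D t x e * D t x f))))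
       = - 2 * (\<Sum>e\<in>UNIV. \<Sum>f\<in>UNIV. \<Sum>x\<in>UNIV. \<nu> x * (k e f * (D t x e * D t x f)))"
      by (simp add: sum_distrib_left sum_negf mult_ac)
    also have "(\<Sum>e\<in>UNIV. \<Sum>f\<in>UNIV. \<Sum>x\<in>UNIV. \<nu> x * (k e f * (D t x e * D t x f)))
       = (\<Sum>e\<in>UNIV. \<Sum>x\<in>UNIV. \<Sum>f\<in>UNIV. \<nu> x * (k e f * (D t x e * D t x f)))"
      by (intro sum.cong refl sum.swap)
    also have "\<dots> = (\<Sum>x\<in>UNIV. \<Sum>e\<in>UNIV. \<Sum>f\<in>UNIV. \<nu> x * (k e f * (D t x e * D t x f)))"
      by (rule sum.swap)
    finally show ?thesis by (simp add: sum_distrib_left)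
  qed
  \<comment> \<open>\<open>\<Phi>\<close> falls no faster than \<open>K * info\<close>: the gradient
    bound is applied for each starting vertex and summed with weights \<open>\<nu>\<close>.\<close>
  have mono: "\<Phi> 0 - K * info \<eta> 0 \<le> \<Phi> t - K * info \<eta> t" if "t \<ge> 0" for t
  proof (rule DERIV_nonneg_imp_nondecreasing[OF that])
    fix s :: real assume s: "0 \<le> s" "s \<le> t"
    define E where "E = (\<lambda>y. energy (\<lambda>x. p s x y) (\<lambda>x. ln (p s x y + \<eta>)))"
    have deriv: "((\<lambda>t. \<Phi> t - K * info \<eta> t) has_real_derivative
      (- 2 * (\<Sum>x\<in>UNIV. \<nu> x * (\<Sum>e\<in>UNIV. \<Sum>f\<in>UNIV. k e f * (D s x e * D s x f)))
        - K * (- (\<Sum>y\<in>UNIV. \<nu> y * E y)))) (at s)"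
      unfolding E_def by (intro DERIV_diff \<Phi>' DERIV_cmult info_has_derivative \<eta> s)
    have "(\<Sum>e\<in>UNIV. \<Sum>f\<in>UNIV. k e f * (D s x e * D s x f)) \<le> W * (1 + \<eta> * N) * E x" for x
    proof -
      have "(\<Sum>e\<in>UNIV. \<Sum>f\<in>UNIV. k e f * (D s x e * D s x f))
         \<le> (\<Sum>e\<in>UNIV. \<Sum>f\<in>UNIV. (\<bar>w e\<bar> * sqrt (c e) * \<bar>D s x e\<bar>) * (\<bar>w f\<bar> * sqrt (c f) * \<bar>D s x f\<bar>))"
      proof (intro sum_mono)
        fix e f
        have "k e f * (D s x e * D s x f) \<le> \<bar>k e f\<bar> * (\<bar>D s x e\<bar> * \<bar>D s x f\<bar>)"
          by (metis abs_ge_self abs_mult)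
        also have "\<dots> \<le> ((\<bar>w e\<bar> * sqrt (c e)) * (\<bar>w f\<bar> * sqrt (c f))) * (\<bar>D s x e\<bar> * \<bar>D s x f\<bar>)"
          by (intro mult_right_mono k) auto
        finally show "k e f * (D s x e * D s x f)
            \<le> (\<bar>w e\<bar> * sqrt (c e) * \<bar>D s x e\<bar>) * (\<bar>w f\<bar> * sqrt (c f) * \<bar>D s x f\<bar>)"
          by (simp add: mult_ac)
      qed
      also have "\<dots> = (\<Sum>e\<in>UNIV. \<bar>w e\<bar> * sqrt (c e) * \<bar>D s x e\<bar>)\<^sup>2"
        by (simp add: power2_eq_square sum_product)
      also have "\<dots> \<le> W * (1 + \<eta> * N) * E x"
        unfolding D_def E_def N_def by (intro weighted_gradient_le \<eta> s W)
      finally show ?thesis .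
    qed
    then have "(\<Sum>x\<in>UNIV. \<nu> x * (\<Sum>e\<in>UNIV. \<Sum>f\<in>UNIV. k e f * (D s x e * D s x f)))
        \<le> (\<Sum>x\<in>UNIV. \<nu> x * (W * (1 + \<eta> * N) * E x))"
      using \<nu>_pos by (intro sum_mono mult_left_mono) (auto simp: less_imp_le)
    also have "\<dots> = W * (1 + \<eta> * N) * (\<Sum>x\<in>UNIV. \<nu> x * E x)"
      by (simp add: sum_distrib_left mult_ac)
    finally show "\<exists>y. ((\<lambda>t. \<Phi> t - K * info \<eta> t) has_real_derivative y) (at s) \<and> 0 \<le> y"
      using deriv by (intro exI conjI) (auto simp: K_def)
  qed
  have bound: "\<Phi> 0 - K * (info \<eta> 0 - N * (1 + \<eta> * N - N)) \<le> \<Phi> t" if "t \<ge> 0" for t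
  proof -
    have "K * (N * (1 + \<eta> * N - N)) \<le> K * info \<eta> t"
      unfolding N_def by (intro mult_left_mono info_lower_bound \<eta> that K)
    then show ?thesis using mono[OF that] by (simp add: right_diff_distrib)
  qed
  \<comment> \<open>Since the energies die out, the total drop of \<open>\<Phi>\<close> is its
    initial value, the quantity to be bounded.\<close>
  have "(\<Phi> \<longlongrightarrow> 0) at_top"
    unfolding \<Phi>_def
    by (intro tendsto_null_sum tendsto_mult_right_zero heat_energy_tendsto_0 flow_solves)
  then have "\<Phi> 0 - K * (info \<eta> 0 - N * (1 + \<eta> * N - N)) \<le> 0"
    by (rule tendsto_lowerbound) (use bound in \<open>auto intro: eventually_at_top_linorderI[of 0]\<close>)
  then show ?thesis by (simp add: \<Phi>_def flow_0 K_def)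
qed

end

text \<open>The kernel is eliminated: it enters the bound only at time 0, where it is diagonal and
  explicit.\<close>

lemma potential_energy_le:
  fixes w :: "'e \<Rightarrow> real" and g :: "'e \<Rightarrow> 'v \<Rightarrow> real"
  assumes \<eta>: "\<eta> > 0"
    and W: "\<And>u. (\<And>x. u x \<ge> 0) \<Longrightarrow>
        (\<Sum>e\<in>UNIV. (w e)\<^sup>2 * ((u (head e) + u (tail e)) / 2)) \<le> W * (\<Sum>x\<in>UNIV. \<nu> x * u x)"
    and W0: "W \<ge> 0"
    and g: "\<And>e x. Lap (g e) x = inc e x"
    and k: "\<And>e f. \<bar>k e f\<bar> \<le> (\<bar>w e\<bar> * sqrt (c e)) * (\<bar>w f\<bar> * sqrt (c f))"
  defines "N \<equiv> \<Sum>x\<in>UNIV. \<nu> x"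
  shows "(\<Sum>e\<in>UNIV. \<Sum>f\<in>UNIV. k e f * energy (g e) (g f))
      \<le> 2 * W * (1 + \<eta> * N) *
          ((\<Sum>y\<in>UNIV. \<Sum>x\<in>UNIV. \<nu> y * (\<nu> x *
              (((if x = y then 1 / \<nu> y else 0) + \<eta>) * ln ((if x = y then 1 / \<nu> y else 0) + \<eta>))))
            - N * (1 + \<eta> * N - N))"
proof -
  obtain p where p: "heat_kernel p" using ex_heat_kernel ..
  show ?thesis
    using potential_energy_le_info[OF p \<eta> W W0 g k, folded N_def]
    unfolding info_def[OF p] kernel_0[OF p] by simp
qed

end

lemma diagm_mult_nth: "(diagm d ** A) $ i $ j = d i * A $ i $ j"
  by (simp add: matrix_matrix_mult_def diagm_def if_distrib[of "\<lambda>u. u * _"] cong: if_cong)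

lemma mult_diagm_nth: "(A ** diagm d) $ i $ j = A $ i $ j * d j"
  by (simp add: matrix_matrix_mult_def diagm_def if_distrib[of "\<lambda>u. _ * u"] cong: if_cong)

section \<open>The projection matrix and the edge measure\<close>

context conductance_graph
begin

lemma laplacian_mult_vec: "(laplacian tail head c *v x) $ v = Lap (($) x) v"
proof -
  have "laplacian tail head c $ v $ z = (\<Sum>e\<in>UNIV. c e * inc e v * inc e z)" for z
    by (simp add: laplacian_def matrix_matrix_mult_def diagm_def transpose_def inc_def mult_ac
        if_distrib[of "\<lambda>u. u * _"] if_distrib[of "\<lambda>u. _ * u"] cong: if_cong)
  then show ?thesis by (simp add: Lap_eq_sum matrix_vector_mult_def sum_negf)
qed

lemma transpose_laplacian: "transpose (laplacian tail head c) = laplacian tail head c"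
proof -
  have "transpose (diagm c) = diagm c" by (auto simp: diagm_def transpose_def vec_eq_iff)
  then show ?thesis by (simp add: laplacian_def matrix_transpose_mul matrix_mul_assoc)
qed

lemma energy_eq_0_imp_grad_eq_0:
  assumes "energy u u = 0"
  shows "grad u e = 0"
  using grad_le_energy[of e u] assms pos[of e]
  by (smt (verit) mult_pos_pos zero_less_power2)

text \<open>The residual \<open>r\<close> lies in the kernel of the Laplacian, so it has zero energy
  and zero gradient along \<open>e\<close>. It is thus orthogonal both to \<open>b\<close> and to
  the range of the Laplacian, hence to itself.\<close>

lemma laplacian_mult_pinv_incidence:
  fixes e :: 'e
  defines "b \<equiv> incidence tail head $ e"
  shows "laplacian tail head c *v (pinv (laplacian tail head c) *v b) = b"
proof -
  define L where "L = laplacian tail head c"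
  define X where "X = pinv L"
  have X: "L ** X ** L = L" "transpose (L ** X) = L ** X"
    using penrose_inverse_pinv[of L] transpose_laplacian by (auto simp: penrose_inverse_def L_def X_def)
  have "L = transpose (L ** X ** L)" using X(1) transpose_laplacian by (simp add: L_def)
  also have "\<dots> = L ** (L ** X)"
    using X(2) transpose_laplacian by (simp add: matrix_transpose_mul L_def)
  finally have LLX: "L ** (L ** X) = L" ..
  define r where "r = b - L *v (X *v b)"
  have Lr: "L *v r = 0"
    using LLX by (simp add: r_def matrix_vector_mult_diff_distrib matrix_vector_mul_assoc)
  have "Lap (($) r) x = 0" for x using Lr laplacian_mult_vec[of r x] by (simp add: L_def)
  then have "energy (($) r) (($) r) = 0" by (simp flip: green)
  then have "grad (($) r) e = 0" by (rule energy_eq_0_imp_grad_eq_0)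
  then have "b \<bullet> r = 0" by (simp add: b_def inner_vec_def flip: sum_inc) (simp add: inc_def)
  moreover have "(L *v (X *v b)) \<bullet> r = 0"
    by (metis Lr L_def dot_lmul_matrix inner_commute inner_zero_left transpose_laplacian transpose_matrix_vector)
  ultimately have "r \<bullet> r = 0" unfolding r_def by (simp add: inner_diff_left inner_diff_right r_def)
  then show ?thesis by (simp add: r_def L_def X_def)
qed

text \<open>The electrical potential of a unit current injected at \<open>head e\<close> and
  extracted at \<open>tail e\<close>.\<close>

definition potential :: "'e \<Rightarrow> 'v \<Rightarrow> real" where
  "potential e x = (pinv (laplacian tail head c) *v (incidence tail head $ e)) $ x"

lemma Lap_potential: "Lap (potential e) x = inc e x"
proof -
  have "potential e = ($) (pinv (laplacian tail head c) *v (incidence tail head $ e))"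
    by (simp add: potential_def fun_eq_iff)
  then show ?thesis
    using laplacian_mult_pinv_incidence[of e] by (simp flip: laplacian_mult_vec add: inc_def)
qed

lemma energy_potential: "energy (potential e) (potential f) = grad (potential f) e"
  by (simp add: Lap_potential mult.commute flip: green sum_inc)

text \<open>The middle factor \<open>b_e^T L^+ b_f\<close> is the gradient of the potential of
  \<open>f\<close> along \<open>e\<close>, which Green's formula turns into an energy that the heat
  flow can track.\<close>

lemma proj_matrix_nth:
  "proj_matrix tail head c $ e $ f = sqrt (c e) * sqrt (c f) * energy (potential e) (potential f)"
proof -
  have "proj_matrix tail head c = diagm (\<lambda>e. sqrt (c e)) ** (incidence tail head **
      pinv (laplacian tail head c) ** transpose (incidence tail head)) ** diagm (\<lambda>e. sqrt (c e))"
    by (simp add: proj_matrix_def matrix_mul_assoc)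
  then have "proj_matrix tail head c $ e $ f = sqrt (c e) * sqrt (c f) *
      (\<Sum>y\<in>UNIV. (\<Sum>x\<in>UNIV. inc e x * pinv (laplacian tail head c) $ x $ y) * inc f y)"
    by (simp add: diagm_mult_nth mult_diagm_nth del: mult_cancel_left)
      (simp add: matrix_matrix_mult_def transpose_def inc_def)
  also have "(\<Sum>y\<in>UNIV. (\<Sum>x\<in>UNIV. inc e x * pinv (laplacian tail head c) $ x $ y) * inc f y)
     = (\<Sum>x\<in>UNIV. inc e x * potential f x)"
    by (simp add: potential_def matrix_vector_mult_def inc_def sum_distrib_left sum_distrib_right mult.assoc)
      (rule sum.swap)
  finally show ?thesis by (simp add: sum_inc energy_potential)
qed

text \<open>After exchanging the sums, each edge is counted at its two distinct ends, and the 2 in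
  the normalization turns this into an average. Constant \<open>u\<close> gives total mass
  1.\<close>

lemma sum_edge_measure:
  fixes w :: "real^'e"
  assumes "w \<noteq> 0"
  shows "(norm w)\<^sup>2 * (\<Sum>x\<in>UNIV. edge_measure tail head w x * u x)
       = (\<Sum>e\<in>UNIV. (w $ e)\<^sup>2 * ((u (head e) + u (tail e)) / 2))"
proof -
  have ind: "(\<Sum>x\<in>UNIV. (if tail e = x \<or> head e = x then (w $ e)\<^sup>2 else 0) * u x)
      = (w $ e)\<^sup>2 * (u (head e) + u (tail e))" for e
  proof -
    have "(\<Sum>x\<in>UNIV. (if tail e = x \<or> head e = x then (w $ e)\<^sup>2 else 0) * u x)
        = (\<Sum>x\<in>{tail e, head e}. (w $ e)\<^sup>2 * u x)"
      by (rule sum.mono_neutral_cong_right) auto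
    then show ?thesis using no_loops[of e] by (simp add: algebra_simps)
  qed
  have "(norm w)\<^sup>2 * (edge_measure tail head w x * u x)
      = (\<Sum>e\<in>{e. tail e = x \<or> head e = x}. (w $ e)\<^sup>2) * u x / 2" for x
    using assms by (simp add: edge_measure_def)
  then have "(norm w)\<^sup>2 * (\<Sum>x\<in>UNIV. edge_measure tail head w x * u x)
      = (\<Sum>x\<in>UNIV. (\<Sum>e\<in>{e. tail e = x \<or> head e = x}. (w $ e)\<^sup>2) * u x) / 2"
    by (simp only: sum_distrib_left sum_divide_distrib)
  also have "(\<Sum>x\<in>UNIV. (\<Sum>e\<in>{e. tail e = x \<or> head e = x}. (w $ e)\<^sup>2) * u x)
      = (\<Sum>e\<in>UNIV. \<Sum>x\<in>UNIV. (if tail e = x \<or> head e = x then (w $ e)\<^sup>2 else 0) * u x)"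
    by (subst sum.swap) (simp add: sum.If_cases flip: sum_distrib_right)
  finally show ?thesis by (simp add: ind sum_divide_distrib)
qed

text \<open>The shift by \<open>\<epsilon>\<close> is needed because the edge measure vanishes at vertices without \<open>w\<close>-mass.\<close>
lemma abs_proj_quadratic_form_le:
  fixes w :: "real^'e"
  assumes w: "w \<noteq> 0" and \<epsilon>: "\<epsilon> > 0"
  defines "\<nu> \<equiv> \<lambda>x. edge_measure tail head w x + \<epsilon>"
  defines "N \<equiv> \<Sum>x\<in>UNIV. \<nu> x"
  shows "\<bar>w \<bullet> (abs_matrix (proj_matrix tail head c) *v w)\<bar> \<le> 2 * (norm w)\<^sup>2 * (1 + \<epsilon> * N) *
          ((\<Sum>y\<in>UNIV. \<Sum>x\<in>UNIV. \<nu> y * (\<nu> x *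
              (((if x = y then 1 / \<nu> y else 0) + \<epsilon>) * ln ((if x = y then 1 / \<nu> y else 0) + \<epsilon>))))
            - N * (1 + \<epsilon> * N - N))"
proof -
  have em: "edge_measure tail head w x \<ge> 0" for x
    by (simp add: edge_measure_def sum_nonneg)
  interpret weighted_conductance_graph tail head c \<nu>
    by unfold_locales (use em \<epsilon> in \<open>simp add: \<nu>_def add_nonneg_pos\<close>)
  define P where "P = (\<lambda>e f. energy (potential e) (potential f))"
  \<comment> \<open>The sign makes \<open>k e f * P e f\<close> the absolute value of the
    corresponding summand.\<close>
  define k where "k = (\<lambda>e f. (\<bar>w $ e\<bar> * sqrt (c e)) * (\<bar>w $ f\<bar> * sqrt (c f)) * sgn (P e f))"
  have "\<bar>w \<bullet> (abs_matrix (proj_matrix tail head c) *v w)\<bar>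
     = \<bar>\<Sum>e\<in>UNIV. \<Sum>f\<in>UNIV. w $ e * (\<bar>proj_matrix tail head c $ e $ f\<bar> * w $ f)\<bar>"
    by (simp add: inner_vec_def matrix_vector_mult_def abs_matrix_def sum_distrib_left)
  also have "\<dots> \<le> (\<Sum>e\<in>UNIV. \<Sum>f\<in>UNIV. \<bar>w $ e * (\<bar>proj_matrix tail head c $ e $ f\<bar> * w $ f)\<bar>)"
    by (rule order_trans[OF sum_abs sum_mono[OF sum_abs]])
  also have "\<dots> = (\<Sum>e\<in>UNIV. \<Sum>f\<in>UNIV. k e f * P e f)"
  proof (intro sum.cong refl)
    fix e f
    have "k e f * P e f = (\<bar>w $ e\<bar> * sqrt (c e)) * (\<bar>w $ f\<bar> * sqrt (c f)) * \<bar>P e f\<bar>"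
      by (simp add: k_def abs_sgn[of "P e f"])
    then show "\<bar>w $ e * (\<bar>proj_matrix tail head c $ e $ f\<bar> * w $ f)\<bar> = k e f * P e f"
      using pos[of e] pos[of f] by (simp add: proj_matrix_nth P_def abs_mult less_imp_le)
  qed
  also have "\<dots> \<le> 2 * (norm w)\<^sup>2 * (1 + \<epsilon> * N) *
          ((\<Sum>y\<in>UNIV. \<Sum>x\<in>UNIV. \<nu> y * (\<nu> x *
              (((if x = y then 1 / \<nu> y else 0) + \<epsilon>) * ln ((if x = y then 1 / \<nu> y else 0) + \<epsilon>))))
            - N * (1 + \<epsilon> * N - N))"
    unfolding P_def N_def
  \<comment> \<open>The same \<open>\<epsilon>\<close> shifts the vertex weights and the argument of
    the logarithm; \<open>W\<close> is the squared norm of \<open>w\<close>.\<close>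
  proof (rule potential_energy_le[OF \<epsilon>, where w = "($) w"])
    fix u :: "'v \<Rightarrow> real" assume u: "\<And>x. u x \<ge> 0"
    have "(\<Sum>e\<in>UNIV. (w $ e)\<^sup>2 * ((u (head e) + u (tail e)) / 2))
        = (norm w)\<^sup>2 * (\<Sum>x\<in>UNIV. edge_measure tail head w x * u x)"
      by (rule sum_edge_measure[OF w, symmetric])
    also have "\<dots> \<le> (norm w)\<^sup>2 * (\<Sum>x\<in>UNIV. \<nu> x * u x)"
      using \<epsilon> u by (intro mult_left_mono sum_mono mult_right_mono) (auto simp: \<nu>_def)
    finally show "(\<Sum>e\<in>UNIV. (w $ e)\<^sup>2 * ((u (head e) + u (tail e)) / 2)) \<le> (norm w)\<^sup>2 * (\<Sum>x\<in>UNIV. \<nu> x * u x)" .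
  next
    show "Lap (potential e) x = inc e x" for e x by (rule Lap_potential)
    show "\<bar>k e f\<bar> \<le> (\<bar>w $ e\<bar> * sqrt (c e)) * (\<bar>w $ f\<bar> * sqrt (c f))" for e f
      using pos[of e] pos[of f] by (auto simp: k_def abs_mult sgn_if)
  qed auto
  finally show ?thesis .
qed

end

section \<open>Removing the regularization\<close>

lemma tendsto_entropy_diagonal:
  fixes m :: real
  assumes "m \<ge> 0"
  shows "((\<lambda>\<epsilon>. (m + \<epsilon>) * ((m + \<epsilon>) * ((1 / (m + \<epsilon>) + \<epsilon>) * ln (1 / (m + \<epsilon>) + \<epsilon>))))
     \<longlongrightarrow> - (if m = 0 then 0 else m * ln m)) (at_right 0)"
proof (cases "m = 0")
  case True
  \<comment> \<open>At a vertex without mass the term behaves like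
    \<open>\<epsilon> * ln (1 / \<epsilon>)\<close>, in accordance with the convention
    \<open>0 log 0 = 0\<close>.\<close>
  have "((\<lambda>\<epsilon>::real. \<epsilon> * (\<epsilon> * ((1 / \<epsilon> + \<epsilon>) * ln (1 / \<epsilon> + \<epsilon>)))) \<longlongrightarrow> 0) (at_right 0)"
    by real_asymp
  then show ?thesis using True by simp
next
  case False
  then have m: "m > 0" using assms by simp
  have "((\<lambda>\<epsilon>. (m + \<epsilon>) * ((m + \<epsilon>) * ((1 / (m + \<epsilon>) + \<epsilon>) * ln (1 / (m + \<epsilon>) + \<epsilon>))))
     \<longlongrightarrow> (m + 0) * ((m + 0) * ((1 / (m + 0) + 0) * ln (1 / (m + 0) + 0)))) (at_right 0)"
    using m by (intro tendsto_intros) auto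
  then show ?thesis using m by (simp add: ln_div)
qed

lemma tendsto_regularized_information:
  fixes \<mu> :: "'v::finite \<Rightarrow> real"
  assumes nonneg: "\<And>x. \<mu> x \<ge> 0" and total: "(\<Sum>x\<in>UNIV. \<mu> x) = 1"
  shows "((\<lambda>\<epsilon>. \<Sum>y\<in>UNIV. \<Sum>x\<in>UNIV. (\<mu> y + \<epsilon>) * ((\<mu> x + \<epsilon>) *
      (((if x = y then 1 / (\<mu> y + \<epsilon>) else 0) + \<epsilon>) * ln ((if x = y then 1 / (\<mu> y + \<epsilon>) else 0) + \<epsilon>))))
     \<longlongrightarrow> entropy \<mu>) (at_right 0)"
proof -
  define h where "h = (\<lambda>y. if \<mu> y = 0 then 0 else \<mu> y * ln (\<mu> y))"
  have lim: "((\<lambda>\<epsilon>. (\<mu> y + \<epsilon>) * ((\<mu> x + \<epsilon>) *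
      (((if x = y then 1 / (\<mu> y + \<epsilon>) else 0) + \<epsilon>) * ln ((if x = y then 1 / (\<mu> y + \<epsilon>) else 0) + \<epsilon>))))
     \<longlongrightarrow> (if x = y then - h y else 0)) (at_right 0)" for x y
  proof (cases "x = y")
    case True
    then show ?thesis using tendsto_entropy_diagonal[OF nonneg, of y] by (simp add: h_def)
  next
    case False
    \<comment> \<open>Off the diagonal the initial kernel is 0, so only the shift remains and these
      terms vanish in the limit.\<close>
    have "((\<lambda>\<epsilon>::real. \<epsilon> * ln \<epsilon>) \<longlongrightarrow> 0) (at_right 0)" by real_asymp
    then have "((\<lambda>\<epsilon>. (\<mu> y + \<epsilon>) * ((\<mu> x + \<epsilon>) * (\<epsilon> * ln \<epsilon>))) \<longlongrightarrow> (\<mu> y + 0) * ((\<mu> x + 0) * 0)) (at_right 0)"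
      by (intro tendsto_mult tendsto_add tendsto_const tendsto_ident_at)
    then show ?thesis using False by simp
  qed
  have "entropy \<mu> = (\<Sum>y\<in>UNIV. \<Sum>x\<in>UNIV. if x = y then - h y else 0)"
    by (simp add: entropy_def h_def sum_negf)
  then show ?thesis by (simp only:) (intro tendsto_sum lim)
qed

theorem theorem1p4:
  fixes tail head :: "'e::finite \<Rightarrow> 'v::finite"
    and c :: "'e \<Rightarrow> real"
    and w :: "real^'e"
  assumes no_loops: "\<And>e. tail e \<noteq> head e"
    and pos: "\<And>e. c e > 0"
    and nonzero: "w \<noteq> 0"
  shows "\<bar>w \<bullet> (abs_matrix (proj_matrix tail head c) *v w)\<bar>
           \<le> 2 * entropy (edge_measure tail head w) * (norm w)^2"
proof -
  interpret conductance_graph tail head c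
    by unfold_locales (use no_loops pos in auto)
  define \<mu> where "\<mu> = edge_measure tail head w"
  define N where "N = (\<lambda>\<epsilon>. \<Sum>x\<in>UNIV. \<mu> x + \<epsilon>)"
  have nonneg: "\<mu> x \<ge> 0" for x by (simp add: \<mu>_def edge_measure_def sum_nonneg)
  have "(norm w)\<^sup>2 = (\<Sum>e\<in>UNIV. (w $ e)\<^sup>2)"
    unfolding power2_norm_eq_inner inner_vec_def by (simp add: power2_eq_square)
  moreover from this have "(\<Sum>e\<in>UNIV. (w $ e)\<^sup>2) \<noteq> 0"
    using nonzero by (metis norm_eq_zero power_eq_0_iff)
  ultimately have total: "(\<Sum>x\<in>UNIV. \<mu> x) = 1"
    using sum_edge_measure[OF nonzero, of "\<lambda>_. 1"] by (simp add: \<mu>_def)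
  have N: "(N \<longlongrightarrow> 1) (at_right 0)"
  proof -
    have "(N \<longlongrightarrow> (\<Sum>x\<in>UNIV. \<mu> x + 0)) (at_right 0)"
      unfolding N_def by (intro tendsto_intros)
    then show ?thesis by (simp add: total)
  qed
  \<comment> \<open>As \<open>N \<epsilon>\<close> tends to 1, the correction from the lower bound
    on the information disappears and only the entropy remains.\<close>
  have "((\<lambda>\<epsilon>. 2 * (norm w)\<^sup>2 * (1 + \<epsilon> * N \<epsilon>) *
          ((\<Sum>y\<in>UNIV. \<Sum>x\<in>UNIV. (\<mu> y + \<epsilon>) * ((\<mu> x + \<epsilon>) *
              (((if x = y then 1 / (\<mu> y + \<epsilon>) else 0) + \<epsilon>) * ln ((if x = y then 1 / (\<mu> y + \<epsilon>) else 0) + \<epsilon>))))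
            - N \<epsilon> * (1 + \<epsilon> * N \<epsilon> - N \<epsilon>)))
     \<longlongrightarrow> 2 * (norm w)\<^sup>2 * (1 + 0 * 1) * (entropy \<mu> - 1 * (1 + 0 * 1 - 1))) (at_right 0)"
    by (intro tendsto_mult tendsto_add tendsto_diff tendsto_const tendsto_ident_at N
        tendsto_regularized_information nonneg total)
  then have "\<bar>w \<bullet> (abs_matrix (proj_matrix tail head c) *v w)\<bar>
      \<le> 2 * (norm w)\<^sup>2 * (1 + 0 * 1) * (entropy \<mu> - 1 * (1 + 0 * 1 - 1))"
  proof (rule tendsto_lowerbound)
    show "\<forall>\<^sub>F \<epsilon> in at_right 0. \<bar>w \<bullet> (abs_matrix (proj_matrix tail head c) *v w)\<bar> \<le>
        2 * (norm w)\<^sup>2 * (1 + \<epsilon> * N \<epsilon>) *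
          ((\<Sum>y\<in>UNIV. \<Sum>x\<in>UNIV. (\<mu> y + \<epsilon>) * ((\<mu> x + \<epsilon>) *
              (((if x = y then 1 / (\<mu> y + \<epsilon>) else 0) + \<epsilon>) * ln ((if x = y then 1 / (\<mu> y + \<epsilon>) else 0) + \<epsilon>))))
            - N \<epsilon> * (1 + \<epsilon> * N \<epsilon> - N \<epsilon>))"
      using eventually_at_right_less[of 0] unfolding N_def \<mu>_def
      by eventually_elim (rule abs_proj_quadratic_form_le[OF nonzero])
  qed simp
  then show ?thesis by (simp add: \<mu>_def mult_ac)
qed

end
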